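(* Let $d\ge 1$ be an integer and let $\mathcal{F}$ be the barycentric subdivision of $(d-1)$-dimensional simplicial complexes. Then its transformation matrix $H_{\mathcal{F}}$ (a $(d+1)\times(d+1)$ real matrix) is totally positive, i.e. all minors of all orders of $H_{\mathcal{F}}$ are non-negative.
   Context: Rows and columns of matrices are indexed starting from $0$. All simplicial complexes are finite. For a $(d-1)$-dimensional simplicial complex $\Delta$ with $f_{i-1}$ faces of dimension $i-1$ ($f_{-1}=1$), the $h$-vector $h^\Delta=(h_0,\dots,h_d)$ is defined by $\sum_{i=0}^d h_i x^i=\sum_{i=0}^d f_{i-1}x^i(1-x)^{d-i}$. The barycentric subdivision of $\Delta$ is the simplicial complex of all chains in the poset of nonempty faces of $\Delta$ ordered by inclusion. Its transformation matrix $H_{\mathcal{F}}$ is the $(d+1)\times(d+1)$ matrix, depending only on $d$, such that $h^{\Delta'}=H_{\mathcal{F}}\,h^{\Delta}$ (column vectors) for every $(d-1)$-dimensional simplicial complex $\Delta$ with barycentric subdivision $\Delta'$. Explicitly (a known result of Brenti and Welker), $$H_{\mathcal F}=\left[\sum_{r=0}^{i} r^j (r+1)^{d-j}(-1)^{i-r}\binom{d+1}{i-r}\right]_{0\le i,j\le d},$$ with the convention $0^0=1$. *)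

theory Defs
  imports
    "HOL-Computational_Algebra.Polynomial"
    "Jordan_Normal_Form.Determinant"
    "Jordan_Normal_Form.DL_Submatrix"
begin

text \<open>
  A finite abstract simplicial complex is given by its set of faces, the empty face included
  (so that \<open>f\<^sub>-\<^sub>1 = 1\<close>).
\<close>

definition abstract_complex :: "'a set set \<Rightarrow> bool" where
  "abstract_complex \<Delta> \<longleftrightarrow>
     finite \<Delta> \<and> {} \<in> \<Delta> \<and> (\<forall>\<sigma>\<in>\<Delta>. finite \<sigma>) \<and> (\<forall>\<sigma>\<in>\<Delta>. \<forall>\<tau>. \<tau> \<subseteq> \<sigma> \<longrightarrow> \<tau> \<in> \<Delta>)"

definition complex_dim :: "'a set set \<Rightarrow> int" where
  "complex_dim \<Delta> = int (Max (card ` \<Delta>)) - 1"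

text \<open>\<open>num_faces \<Delta> i\<close> is \<open>f\<close> with index \<open>i - 1\<close>: a face of dimension \<open>i - 1\<close> has \<open>i\<close> vertices.\<close>

definition num_faces :: "'a set set \<Rightarrow> nat \<Rightarrow> nat" where
  "num_faces \<Delta> i = card {\<sigma> \<in> \<Delta>. card \<sigma> = i}"

definition h_polynomial :: "'a set set \<Rightarrow> real poly" where
  "h_polynomial \<Delta> =
     (let d = nat (complex_dim \<Delta> + 1)
      in \<Sum>i=0..d. of_nat (num_faces \<Delta> i) * [:0, 1:] ^ i * [:1, - 1:] ^ (d - i))"

definition h_vector :: "'a set set \<Rightarrow> real vec" where
  "h_vector \<Delta> = vec (nat (complex_dim \<Delta> + 1) + 1) (\<lambda>i. coeff (h_polynomial \<Delta>) i)"

text \<open>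
  The library's \<open>chains P\<close> is the set of all subsets of \<open>P\<close> that are totally ordered by inclusion;
  the empty chain is the empty face of the subdivision.
\<close>

definition barycentric_subdivision :: "'a set set \<Rightarrow> 'a set set set" where
  "barycentric_subdivision \<Delta> = chains (\<Delta> - {{}})"

text \<open>
  Quantification over all complexes is over complexes with vertices in \<open>nat\<close>; every finite complex
  is isomorphic to one of these.  The definite description is proper: the \<open>f\<close>-vector, hence the
  \<open>h\<close>-vector, of the subdivision is a linear function of that of \<open>\<Delta>\<close>, and for \<open>d \<ge> 1\<close> the \<open>h\<close>-vectors
  of the \<open>(d-1)\<close>-dimensional complexes span the space of all vectors of dimension \<open>d + 1\<close>.
\<close>

definition barycentric_transformation_matrix :: "nat \<Rightarrow> real mat" where
  "barycentric_transformation_matrix d =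
     (THE H. H \<in> carrier_mat (d + 1) (d + 1) \<and>
        (\<forall>\<Delta> :: nat set set. abstract_complex \<Delta> \<and> complex_dim \<Delta> = int d - 1 \<longrightarrow>
           h_vector (barycentric_subdivision \<Delta>) = H *\<^sub>v h_vector \<Delta>))"

definition totally_positive :: "real mat \<Rightarrow> bool" where
  "totally_positive A \<longleftrightarrow>
     (\<forall>I J. I \<subseteq> {..<dim_row A} \<and> J \<subseteq> {..<dim_col A} \<and> card I = card J \<longrightarrow>
        det (submatrix A I J) \<ge> 0)"

end

theory Submission
  imports Defs
begin

text \<open>
  Column \<open>j\<close> of the transformation matrix in dimension \<open>d - 1\<close> is the coefficient vector of the
  polynomial \<open>p\<^sub>d\<^sub>,\<^sub>j = (1 - x)\<^bsup>d+1\<^esup> \<Sum>\<^sub>r r\<^bsup>j\<^esup> (r + 1)\<^bsup>d-j\<^esup> x\<^bsup>r\<^esup>\<close>.  Multiplying the summand by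
  \<open>r + 1\<close> or by \<open>r\<close> acts on the coefficients by a nonnegative bidiagonal matrix, so both the first
  \<open>d + 1\<close> and the last \<open>d + 1\<close> columns of the matrix for \<open>d + 1\<close> arise from the matrix for \<open>d\<close> by a
  nonnegative combination of adjacent rows.  By induction, all minors formed from interior rows and
  missing the first or the last column are strictly positive; a minor containing both columns omits
  some column in between, and the three-term Pluecker relation expresses it by positive ones.
  The first and last rows are unit vectors, so the remaining minors reduce to these.
\<close>

subsection \<open>Minors\<close>

text \<open>Arbitrary index functions allow repeated rows or columns and turn the deletion of one
  into composition with \<open>insert_index\<close>.\<close>

definition minor :: "(nat \<Rightarrow> nat \<Rightarrow> real) \<Rightarrow> nat \<Rightarrow> (nat \<Rightarrow> nat) \<Rightarrow> (nat \<Rightarrow> nat) \<Rightarrow> real" where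
  "minor a n r c = det (mat n n (\<lambda>(i, j). a (r i) (c j)))"

lemma minor_0 [simp]: "minor a 0 r c = 1"
  by (simp add: minor_def)

lemma minor_cong:
  assumes "\<And>i j. i < n \<Longrightarrow> j < n \<Longrightarrow> a (r i) (c j) = a' (r' i) (c' j)"
  shows "minor a n r c = minor a' n r' c'"
  unfolding minor_def by (rule arg_cong[of _ _ det], rule eq_matI) (use assms in auto)

lemma mat_delete_minor:
  assumes "p < Suc n" "s < Suc n"
  shows "det (mat_delete (mat (Suc n) (Suc n) (\<lambda>(i, j). a (r i) (c j))) p s) =
    minor a n (r \<circ> insert_index p) (c \<circ> insert_index s)"
  unfolding minor_def
  by (rule arg_cong[of _ _ det], rule eq_matI)
    (use assms in \<open>auto simp: mat_delete_def insert_index_def\<close>)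

lemma minor_expand_row:
  assumes "p < Suc n"
  shows "minor a (Suc n) r c =
    (\<Sum>s<Suc n. (-1)^(p+s) * a (r p) (c s) * minor a n (r \<circ> insert_index p) (c \<circ> insert_index s))"
proof -
  have "minor a (Suc n) r c = (\<Sum>s<Suc n. mat (Suc n) (Suc n) (\<lambda>(i, j). a (r i) (c j)) $$ (p, s) *
      cofactor (mat (Suc n) (Suc n) (\<lambda>(i, j). a (r i) (c j))) p s)"
    unfolding minor_def by (rule laplace_expansion_row) (use assms in auto)
  also have "\<dots> = (\<Sum>s<Suc n. (-1)^(p+s) * a (r p) (c s) *
      minor a n (r \<circ> insert_index p) (c \<circ> insert_index s))"
    by (rule sum.cong) (use assms in \<open>auto simp: cofactor_def mat_delete_minor\<close>)
  finally show ?thesis .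
qed

lemma minor_expand_column:
  assumes "s < Suc n"
  shows "minor a (Suc n) r c =
    (\<Sum>p<Suc n. (-1)^(p+s) * a (r p) (c s) * minor a n (r \<circ> insert_index p) (c \<circ> insert_index s))"
proof -
  have "minor a (Suc n) r c = (\<Sum>p<Suc n. mat (Suc n) (Suc n) (\<lambda>(i, j). a (r i) (c j)) $$ (p, s) *
      cofactor (mat (Suc n) (Suc n) (\<lambda>(i, j). a (r i) (c j))) p s)"
    unfolding minor_def by (rule laplace_expansion_column) (use assms in auto)
  also have "\<dots> = (\<Sum>p<Suc n. (-1)^(p+s) * a (r p) (c s) *
      minor a n (r \<circ> insert_index p) (c \<circ> insert_index s))"
    by (rule sum.cong) (use assms in \<open>auto simp: cofactor_def mat_delete_minor\<close>)
  finally show ?thesis .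
qed

lemma minor_equal_rows:
  assumes "p < n" "q < n" "p \<noteq> q" "r p = r q"
  shows "minor a n r c = 0"
  unfolding minor_def
  by (rule det_identical_rows[of _ n p q]) (use assms in \<open>auto intro!: eq_vecI\<close>)

lemma minor_equal_columns:
  assumes "p < n" "q < n" "p \<noteq> q" "c p = c q"
  shows "minor a n r c = 0"
  unfolding minor_def
  by (rule det_identical_columns[of _ n p q]) (use assms in \<open>auto intro!: eq_vecI\<close>)

lemma insert_index_0 [simp]: "insert_index 0 = Suc"
  by (auto simp: insert_index_def)

text \<open>Among the \<open>n + 3\<close> columns \<open>x\<close>, the first, the one at position
  \<open>Suc m\<close> and the last are singled out. Signed maximal minors give a linear dependence
  of all columns; a functional killing the other \<open>n\<close> leaves three terms.\<close>

lemma minor_three_term: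
  fixes x :: "nat \<Rightarrow> nat"
  assumes "m \<le> n"
  defines "y \<equiv> x \<circ> insert_index (Suc m)"
  shows "minor a (Suc (Suc n)) r y * minor a (Suc n) (r \<circ> Suc) (x \<circ> Suc) =
    minor a (Suc (Suc n)) r (x \<circ> Suc) * minor a (Suc n) (r \<circ> Suc) y +
    minor a (Suc (Suc n)) r x * minor a (Suc n) (r \<circ> Suc) (y \<circ> Suc)"
proof -
  define e where "e i = (-1)^i * minor a n (r \<circ> Suc \<circ> insert_index i) (y \<circ> Suc)" for i
  \<comment> \<open>\<open>D z\<close> is the minor on the rows \<open>r \<circ> Suc\<close> with
    the columns \<open>z, y 1, ..., y n\<close>, expanded along its first column and so linear in
    it.\<close>
  define D where "D z = (\<Sum>i<Suc n. a (r (Suc i)) z * e i)" for z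
  define u where "u s = (-1)^s * minor a (Suc (Suc n)) r (x \<circ> insert_index s)" for s
  have D1: "minor a (Suc n) (r \<circ> Suc) (x \<circ> Suc) = (-1)^m * D (x (Suc m))"
  proof -
    have "x \<circ> Suc \<circ> insert_index m = y \<circ> Suc"
      by (auto simp: y_def insert_index_def)
    then show ?thesis using assms
      by (subst minor_expand_column[of m])
        (auto simp: D_def e_def sum_distrib_left power_add mult_ac simp del: sum.lessThan_Suc
           intro!: sum.cong)
  qed
  have D0: "minor a (Suc n) (r \<circ> Suc) y = D (x 0)"
    by (subst minor_expand_column[of 0])
      (auto simp: D_def e_def y_def insert_index_def mult_ac simp del: sum.lessThan_Suc intro!: sum.cong)
  have D2: "minor a (Suc n) (r \<circ> Suc) (y \<circ> Suc) = (-1)^n * D (x (Suc (Suc n)))"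
  proof -
    have "minor a n q (y \<circ> Suc \<circ> insert_index n) = minor a n q (y \<circ> Suc)" for q
      by (rule minor_cong) (auto simp: insert_index_def)
    moreover have "y (Suc n) = x (Suc (Suc n))" using assms by (auto simp: y_def insert_index_def)
    ultimately show ?thesis
      by (subst minor_expand_column[of n])
        (auto simp: D_def e_def sum_distrib_left power_add mult_ac simp del: sum.lessThan_Suc
           intro!: sum.cong)
  qed
  have Dz: "D (y (Suc t)) = 0" if "t < n" for t
  proof -
    have "D (y (Suc t)) = minor a (Suc n) (r \<circ> Suc) (case_nat (y (Suc t)) (y \<circ> Suc))"
      by (subst minor_expand_column[of 0])
        (auto simp: D_def e_def comp_def mult_ac simp del: sum.lessThan_Suc intro!: sum.cong)
    also have "\<dots> = 0"
      by (rule minor_equal_columns[of 0 _ "Suc t"]) (use that in auto)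
    finally show ?thesis .
  qed
  \<comment> \<open>Doubling row \<open>r i\<close> gives a vanishing determinant; its expansion
    along the added row is the dependence.\<close>
  have u: "(\<Sum>s<Suc (Suc (Suc n)). a (r i) (x s) * u s) = 0" if "i < Suc (Suc n)" for i
  proof -
    have "0 = minor a (Suc (Suc (Suc n))) (case_nat (r i) r) x"
      by (rule minor_equal_rows[of 0 _ "Suc i", symmetric]) (use that in auto)
    also have "\<dots> = (\<Sum>s<Suc (Suc (Suc n)). a (r i) (x s) * u s)"
      by (subst minor_expand_row[of 0])
        (auto simp: u_def comp_def mult_ac simp del: sum.lessThan_Suc intro!: sum.cong)
    finally show ?thesis by simp
  qed
  have "(\<Sum>s<Suc (Suc (Suc n)). u s * D (x s)) =
      (\<Sum>i<Suc n. e i * (\<Sum>s<Suc (Suc (Suc n)). a (r (Suc i)) (x s) * u s))"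
    unfolding D_def sum_distrib_left by (subst sum.swap) (simp add: mult_ac del: sum.lessThan_Suc)
  also have "\<dots> = 0" by (rule sum.neutral) (use u in auto)
  finally have "0 = (\<Sum>s<Suc (Suc (Suc n)). u s * D (x s))" by simp
  also have "\<dots> = (\<Sum>s\<in>{0, Suc m, Suc (Suc n)}. u s * D (x s))"
  proof (rule sum.mono_neutral_right)
    show "\<forall>s\<in>{..<Suc (Suc (Suc n))} - {0, Suc m, Suc (Suc n)}. u s * D (x s) = 0"
    proof
      fix s assume s: "s \<in> {..<Suc (Suc (Suc n))} - {0, Suc m, Suc (Suc n)}"
      then have "\<exists>t<n. x s = y (Suc t)"
        using assms(1)
        by (intro exI[of _ "if s < Suc m then s - 1 else s - 2"])
          (auto simp: y_def insert_index_def intro!: arg_cong[of _ _ x])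
      then show "u s * D (x s) = 0" using Dz by auto
    qed
  qed (use assms in auto)
  also have "\<dots> = u 0 * D (x 0) + u (Suc m) * D (x (Suc m)) + u (Suc (Suc n)) * D (x (Suc (Suc n)))"
    using assms(1) by auto
  finally have *: "u 0 * D (x 0) + u (Suc m) * D (x (Suc m)) + u (Suc (Suc n)) * D (x (Suc (Suc n))) = 0"
    by simp
  have "minor a (Suc (Suc n)) r (x \<circ> insert_index (Suc (Suc n))) = minor a (Suc (Suc n)) r x"
    by (rule minor_cong) (auto simp: insert_index_def)
  with * show ?thesis
    unfolding D0 D1 D2 by (auto simp: u_def y_def algebra_simps)
qed

text \<open>Multilinearity in all rows at once: \<open>prod_add\<close> expands the product in each
  Leibniz term.\<close>

lemma det_rows_add:
  fixes u v :: "nat \<Rightarrow> nat \<Rightarrow> real"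
  shows "det (mat n n (\<lambda>(i, j). \<alpha> i * u i j + \<beta> i * v i j)) =
    (\<Sum>S\<in>Pow {..<n}. prod \<alpha> S * prod \<beta> ({..<n} - S) *
      det (mat n n (\<lambda>(i, j). if i \<in> S then u i j else v i j)))"
proof -
  have *: "(\<Prod>i<n. \<alpha> i * u i (p i) + \<beta> i * v i (p i)) = (\<Sum>S\<in>Pow {..<n}. prod \<alpha> S *
      prod \<beta> ({..<n} - S) * (\<Prod>i<n. if i \<in> S then u i (p i) else v i (p i)))" for p
  proof -
    have "(\<Prod>i<n. if i \<in> S then u i (p i) else v i (p i)) =
        (\<Prod>i\<in>S. u i (p i)) * (\<Prod>i\<in>{..<n} - S. v i (p i))" if "S \<subseteq> {..<n}" for S
      using that by (subst prod.If_cases) (auto simp: Int_absorb1 Diff_eq)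
    then show ?thesis
      by (subst prod_add) (auto simp: prod.distrib mult_ac intro!: sum.cong)
  qed
  have p: "p i < n" if "p permutes {0..<n}" "i < n" for p i
    using permutes_in_image[OF that(1), of i] that(2) by auto
  show ?thesis
    using p unfolding det_def
    by (simp add: sum_distrib_left sum.swap[of _ _ "Pow _"] atLeast0LessThan * mult_ac)
qed

subsection \<open>Propagation of positivity\<close>

text \<open>An increasing enumeration of an \<open>n\<close>-element subset of \<open>A\<close>;
  values at arguments \<open>\<ge> n\<close> are left open.\<close>

definition increasing_in :: "nat \<Rightarrow> nat set \<Rightarrow> (nat \<Rightarrow> nat) \<Rightarrow> bool" where
  "increasing_in n A r \<longleftrightarrow> strict_mono_on {..<n} r \<and> r ` {..<n} \<subseteq> A"

lemma increasing_inI: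
  assumes "\<And>i j. i < j \<Longrightarrow> j < n \<Longrightarrow> r i < r j" "\<And>i. i < n \<Longrightarrow> r i \<in> A"
  shows "increasing_in n A r"
  using assms by (auto simp: increasing_in_def strict_mono_on_def)

lemma increasing_inD:
  assumes "increasing_in n A r"
  shows "i < j \<Longrightarrow> j < n \<Longrightarrow> r i < r j" "i < n \<Longrightarrow> r i \<in> A"
  using assms by (auto simp: increasing_in_def strict_mono_on_def)

lemma increasing_in_le:
  assumes "increasing_in n A r" "i \<le> j" "j < n"
  shows "r i \<le> r j"
  using increasing_inD(1)[OF assms(1), of i j] assms by (cases "i = j") auto

lemma increasing_in_first_eq_0:
  assumes "increasing_in (Suc m) A r" "0 \<in> r ` {..<Suc m}"
  shows "r 0 = 0"
  using assms(2) increasing_in_le[OF assms(1), of 0] by fastforce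

lemma increasing_in_last_eq:
  assumes "increasing_in (Suc m) A r" "A \<subseteq> {..d}" "d \<in> r ` {..<Suc m}"
  shows "r m = d"
proof -
  obtain i where i: "i < Suc m" "r i = d" using assms(3) by auto
  then have "d \<le> r m" using increasing_in_le[OF assms(1), of i m] by simp
  moreover have "r m \<in> A" using increasing_inD(2)[OF assms(1)] by simp
  ultimately show ?thesis using assms(2) by fastforce
qed

lemma increasing_in_index_le:
  assumes "increasing_in n A r" "i < n"
  shows "i \<le> r i"
  using assms(2)
proof (induction i)
  case (Suc i)
  then show ?case using increasing_inD(1)[OF assms(1), of i "Suc i"] by simp
qed simp

lemma increasing_in_Suc:
  assumes "increasing_in (Suc n) A r"
  shows "increasing_in n (A \<inter> {r 0<..}) (r \<circ> Suc)"
  using increasing_inD[OF assms] by (intro increasing_inI) auto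

lemma increasing_in_butlast:
  assumes "increasing_in (Suc n) A r"
  shows "increasing_in n (A \<inter> {..<r n}) r"
  using increasing_inD[OF assms] by (intro increasing_inI) auto

lemma increasing_in_mono:
  assumes "increasing_in n A r" "A \<subseteq> B"
  shows "increasing_in n B r"
  using assms by (auto simp: increasing_in_def)

lemma increasing_in_Diff:
  assumes "increasing_in n A r" "x \<notin> r ` {..<n}"
  shows "increasing_in n (A - {x}) r"
  using assms by (auto simp: increasing_in_def)

text \<open>Rows \<open>0\<close> and \<open>d\<close> are unit vectors, so strict positivity can only be asked of the rows between
  them; it is what allows one to divide in the three-term relation.\<close>

definition interior_positive :: "nat \<Rightarrow> (nat \<Rightarrow> nat \<Rightarrow> real) \<Rightarrow> bool" where
  "interior_positive d a \<longleftrightarrow>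
     (\<forall>j\<le>d. a 0 j = of_bool (j = 0)) \<and> (\<forall>j\<le>d. a d j = of_bool (j = d)) \<and>
     (\<forall>n r c. increasing_in n {1..<d} r \<longrightarrow> increasing_in n {..d} c \<longrightarrow> minor a n r c > 0)"

section \<open>Minors that meet the unit rows\<close>

text \<open>The expansion along this row sees only column \<open>0\<close>, which an increasing
  \<open>c\<close> can have only in first place.\<close>

lemma minor_unit_first_row:
  assumes a: "\<And>j. j \<le> d \<Longrightarrow> a 0 j = of_bool (j = 0)"
    and r: "r 0 = 0" and c: "increasing_in (Suc n) {..d} c"
  shows "minor a (Suc n) r c = of_bool (c 0 = 0) * minor a n (r \<circ> Suc) (c \<circ> Suc)"
proof -
  have "a 0 (c s) = 0" if "s < Suc n" "s \<noteq> 0" for s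
    using a[of "c s"] increasing_inD[OF c, of s] increasing_inD(1)[OF c, of 0 s] that by auto
  moreover have "a 0 (c 0) = of_bool (c 0 = 0)"
    using a[of "c 0"] increasing_inD[OF c, of 0] by auto
  ultimately show ?thesis
    by (simp add: minor_expand_row[of 0] r sum.lessThan_Suc_shift del: sum.lessThan_Suc)
qed

lemma minor_unit_last_row:
  assumes a: "\<And>j. j \<le> d \<Longrightarrow> a d j = of_bool (j = d)"
    and r: "r n = d" and c: "increasing_in (Suc n) {..d} c"
  shows "minor a (Suc n) r c = of_bool (c n = d) * minor a n r c"
proof -
  have "a d (c s) = 0" if "s < n" for s
  proof -
    have "c s < d" using increasing_inD(1)[OF c, of s n] increasing_inD(2)[OF c, of n] that by simp
    then show ?thesis using a[of "c s"] by simp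
  qed
  moreover have "a d (c n) = of_bool (c n = d)"
    using a[of "c n"] increasing_inD[OF c, of n] by auto
  moreover have "minor a n (r \<circ> insert_index n) (c \<circ> insert_index n) = minor a n r c"
    by (rule minor_cong) (auto simp: insert_index_def)
  ultimately show ?thesis
    by (simp add: minor_expand_row[of n] r)
qed

text \<open>Peeling off the unit row \<open>d\<close>, if chosen, leaves interior rows, so a zero
  can only come from choosing row \<open>d\<close> without column \<open>d\<close>.\<close>

lemma minor_lower_rows:
  assumes a: "interior_positive d a" and r: "increasing_in n {1..d} r" and c: "increasing_in n {..d} c"
  shows "minor a n r c \<ge> 0"
    and "(d \<in> r ` {..<n} \<Longrightarrow> d \<in> c ` {..<n}) \<Longrightarrow> minor a n r c > 0"
proof -
  have "minor a n r c \<ge> 0 \<and> ((d \<in> r ` {..<n} \<longrightarrow> d \<in> c ` {..<n}) \<longrightarrow> minor a n r c > 0)"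
  proof (cases "d \<in> r ` {..<n}")
    case False
    then have "increasing_in n {1..<d} r"
      by (intro increasing_in_mono[OF increasing_in_Diff[OF r]]) auto
    then have "minor a n r c > 0" using a c by (auto simp: interior_positive_def)
    then show ?thesis by auto
  next
    case True
    then obtain m where n: "n = Suc m" by (cases n) auto
    have rm: "r m = d"
      using increasing_in_last_eq[OF r[unfolded n]] True n by auto
    have *: "minor a n r c = of_bool (c m = d) * minor a m r c"
      unfolding n by (rule minor_unit_last_row) (use a rm c n in \<open>auto simp: interior_positive_def\<close>)
    have "increasing_in m {1..<d} r" "increasing_in m {..d} c"
      using increasing_in_butlast[OF r[unfolded n]] increasing_in_butlast[OF c[unfolded n]] rm
      by (auto elim!: increasing_in_mono)
    then have pos: "minor a m r c > 0" using a by (auto simp: interior_positive_def)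
    have "c m = d" if "d \<in> c ` {..<n}"
      using increasing_in_last_eq[OF c[unfolded n]] that n by auto
    then show ?thesis using * pos True by auto
  qed
  then show "minor a n r c \<ge> 0"
    and "(d \<in> r ` {..<n} \<Longrightarrow> d \<in> c ` {..<n}) \<Longrightarrow> minor a n r c > 0" by blast+
qed

lemma minor_all_rows:
  assumes a: "interior_positive d a" and r: "increasing_in n {..d} r" and c: "increasing_in n {..d} c"
  shows "minor a n r c \<ge> 0"
    and "(0 \<in> r ` {..<n} \<Longrightarrow> 0 \<in> c ` {..<n}) \<Longrightarrow> (d \<in> r ` {..<n} \<Longrightarrow> d \<in> c ` {..<n}) \<Longrightarrow>
      d > 0 \<Longrightarrow> minor a n r c > 0"
proof -
  have "minor a n r c \<ge> 0 \<and> ((0 \<in> r ` {..<n} \<longrightarrow> 0 \<in> c ` {..<n}) \<and> (d \<in> r ` {..<n} \<longrightarrow> d \<in> c ` {..<n})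
      \<and> d > 0 \<longrightarrow> minor a n r c > 0)"
  proof (cases "0 \<in> r ` {..<n}")
    case False
    then have "increasing_in n {1..d} r"
      by (intro increasing_in_mono[OF increasing_in_Diff[OF r]]) auto
    then show ?thesis using minor_lower_rows[OF a _ c] by blast
  next
    case True
    then obtain m where n: "n = Suc m" by (cases n) auto
    have r0: "r 0 = 0"
      using increasing_in_first_eq_0[OF r[unfolded n]] True n by auto
    have *: "minor a n r c = of_bool (c 0 = 0) * minor a m (r \<circ> Suc) (c \<circ> Suc)"
      unfolding n by (rule minor_unit_first_row) (use a r0 c n in \<open>auto simp: interior_positive_def\<close>)
    have inc: "increasing_in m {1..d} (r \<circ> Suc)" "increasing_in m {..d} (c \<circ> Suc)"
      using increasing_in_Suc[OF r[unfolded n]] increasing_in_Suc[OF c[unfolded n]] r0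
      by (auto elim!: increasing_in_mono)
    have c0: "c 0 = 0" if "0 \<in> c ` {..<n}"
      using increasing_in_first_eq_0[OF c[unfolded n]] that n by auto
    \<comment> \<open>As \<open>d > 0\<close>, column \<open>d\<close> survives the removal of
      column \<open>0\<close>.\<close>
    have "d \<in> (c \<circ> Suc) ` {..<m}" if "d \<in> c ` {..<n}" "c 0 = 0" "d > 0"
      using that unfolding n lessThan_Suc_eq_insert_0 by (auto simp: image_comp)
    moreover have "d \<in> r ` {..<n}" if "d \<in> (r \<circ> Suc) ` {..<m}"
      using that n by auto
    ultimately show ?thesis
      using * minor_lower_rows[OF a inc] c0 True by auto
  qed
  then show "minor a n r c \<ge> 0"
    and "(0 \<in> r ` {..<n} \<Longrightarrow> 0 \<in> c ` {..<n}) \<Longrightarrow> (d \<in> r ` {..<n} \<Longrightarrow> d \<in> c ` {..<n}) \<Longrightarrow>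
      d > 0 \<Longrightarrow> minor a n r c > 0" by blast+
qed

section \<open>Passing positivity from one dimension to the next\<close>

text \<open>By multilinearity the minor of \<open>b\<close> is a positive combination of minors of
  \<open>a\<close> in which each row \<open>r i\<close> is kept or lowered by one. All of these are
  nonnegative and some choice is positive.\<close>

lemma minor_bidiagonal_pos:
  assumes a: "interior_positive d a" and d: "d > 0"
    and b: "\<And>i j. i \<in> {1..d} \<Longrightarrow> j \<le> d \<Longrightarrow> b i j = \<alpha> i * a i j + \<beta> i * a (i - 1) j"
    and ab: "\<And>i. i \<in> {1..d} \<Longrightarrow> \<alpha> i > 0" "\<And>i. i \<in> {1..d} \<Longrightarrow> \<beta> i > 0"
    and r: "increasing_in n {1..d} r" and c: "increasing_in n {..d} c"
  shows "minor b n r c > 0"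
proof -
  define q where "q S i = (if i \<in> S then r i else r i - 1)" for S i
  define w where "w S = (\<Prod>i\<in>S. \<alpha> (r i)) * (\<Prod>i\<in>{..<n} - S. \<beta> (r i))" for S
  have "minor b n r c = det (mat n n (\<lambda>(i, j). \<alpha> (r i) * a (r i) (c j) + \<beta> (r i) * a (r i - 1) (c j)))"
    unfolding minor_def
    using increasing_inD(2)[OF r] increasing_inD(2)[OF c] b
    by (intro arg_cong[of _ _ det] eq_matI) simp_all
  also have "\<dots> = (\<Sum>S\<in>Pow {..<n}. w S * minor a n (q S) c)"
    by (subst det_rows_add) (auto simp: w_def minor_def q_def intro!: sum.cong arg_cong[of _ _ det] eq_matI)
  finally have eq: "minor b n r c = (\<Sum>S\<in>Pow {..<n}. w S * minor a n (q S) c)" .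
  have w: "w S > 0" if "S \<subseteq> {..<n}" for S
    unfolding w_def using that ab increasing_inD(2)[OF r] by (intro mult_pos_pos prod_pos) auto
  \<comment> \<open>Lowering increasing rows by at most one keeps them weakly increasing, so only
    coincidences can spoil strictness.\<close>
  have q_inc: "increasing_in n {..d} (q S)" if "\<And>i j. i < j \<Longrightarrow> j < n \<Longrightarrow> q S i \<noteq> q S j" for S
  proof (rule increasing_inI)
    fix i j assume "i < j" "j < n"
    then show "q S i < q S j"
      using that[of i j] increasing_inD(1)[OF r, of i j] by (auto simp: q_def split: if_splits)
  next
    fix i assume "i < n"
    then show "q S i \<in> {..d}" using increasing_inD(2)[OF r, of i] by (auto simp: q_def)
  qed
  have nonneg: "minor a n (q S) c \<ge> 0" for S
  proof (cases "\<exists>i j. i < j \<and> j < n \<and> q S i = q S j")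
    case True
    then obtain i j where "i < j" "j < n" "q S i = q S j" by blast
    then show ?thesis using minor_equal_rows[of i n j "q S" a c] by simp
  next
    case False
    then show ?thesis using minor_all_rows(1)[OF a q_inc c] by blast
  qed
  have "\<exists>S\<in>Pow {..<n}. minor a n (q S) c > 0"
  proof (cases "\<exists>t\<in>{1..d}. t \<notin> r ` {..<n}")
    case True
    then obtain t where t: "t \<in> {1..d}" "t \<notin> r ` {..<n}" by blast
    \<comment> \<open>Rows below the gap \<open>t\<close> stay and rows above it go down; this
      avoids \<open>0\<close> and \<open>d\<close> and creates no coincidence.\<close>
    define S where "S = {i. i < n \<and> r i < t}"
    have t': "r i \<noteq> t" if "i < n" for i using t that by blast
    have "increasing_in n {1..<d} (q S)"
    proof (rule increasing_inI)
      fix i j assume "i < j" "j < n"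
      then show "q S i < q S j"
        using increasing_inD(1)[OF r, of i j] t'[of i] t'[of j] by (auto simp: q_def S_def)
    next
      fix i assume "i < n"
      then show "q S i \<in> {1..<d}"
        using increasing_inD(2)[OF r, of i] t'[of i] t(1) by (auto simp: q_def S_def)
    qed
    then have "minor a n (q S) c > 0" using a c by (auto simp: interior_positive_def)
    then show ?thesis by (auto simp: S_def)
  next
    case False
    then have img: "r ` {..<n} = {1..d}" using r by (auto simp: increasing_in_def)
    have inj: "inj_on f {..<n}" if "increasing_in n A f" for f A
      using that strict_mono_on_imp_inj_on by (auto simp: increasing_in_def)
    have n: "n = d" using card_image[OF inj[OF r]] img by simp
    \<comment> \<open>The \<open>d\<close> chosen columns do not fit into the \<open>d - 1\<close>
      inner ones.\<close>
    have "0 \<in> c ` {..<n} \<or> d \<in> c ` {..<n}"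
    proof (rule ccontr)
      assume "\<not> ?thesis"
      then have "c ` {..<n} \<subseteq> {1..<d}"
        using increasing_inD(2)[OF c] by (fastforce simp: Suc_le_eq)
      from card_mono[OF _ this] show False using card_image[OF inj[OF c]] n d by simp
    qed
    then show ?thesis
    proof
      \<comment> \<open>Lowering all rows gives \<open>0\<close> to \<open>d - 1\<close>, where
        column \<open>0\<close> serves the unit row \<open>0\<close>. In the other case keeping all
        rows gives \<open>1\<close> to \<open>d\<close>, where column \<open>d\<close> serves row
        \<open>d\<close>.\<close>
      assume 0: "0 \<in> c ` {..<n}"
      have "q {} i \<noteq> d" if "i < n" for i
        using increasing_inD(2)[OF r that] by (auto simp: q_def)
      moreover have "increasing_in n {..d} (q {})"
      proof (rule q_inc)
        fix i j assume "i < j" "j < n"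
        then show "q {} i \<noteq> q {} j"
          using increasing_inD(1)[OF r, of i j] increasing_inD(2)[OF r, of i]
          by (auto simp: q_def)
      qed
      ultimately have "minor a n (q {}) c > 0"
        using 0 d by (intro minor_all_rows(2)[OF a _ c]) auto
      then show ?thesis by auto
    next
      assume "d \<in> c ` {..<n}"
      moreover have "minor a n (q {..<n}) c = minor a n r c"
        by (rule minor_cong) (auto simp: q_def)
      ultimately have "minor a n (q {..<n}) c > 0"
        using minor_lower_rows(2)[OF a r c] by auto
      then show ?thesis by auto
    qed
  qed
  then obtain S where S: "S \<in> Pow {..<n}" "minor a n (q S) c > 0" by blast
  show ?thesis
    unfolding eq
    by (rule sum_pos2[OF _ S(1)]) (use S w nonneg in \<open>auto intro!: mult_nonneg_nonneg less_imp_le[OF w]\<close>)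
qed

text \<open>A minor containing the first and the last column is reached from minors missing one of them
  by the three-term relation, applied with a column that the minor omits.\<close>

lemma minor_outer_columns_pos:
  fixes b :: "nat \<Rightarrow> nat \<Rightarrow> real"
  assumes left: "\<And>n r c. increasing_in n {1..d} r \<Longrightarrow> increasing_in n {..d} c \<Longrightarrow> minor b n r c > 0"
    and right: "\<And>n r c. increasing_in n {1..d} r \<Longrightarrow> increasing_in n {1..Suc d} c \<Longrightarrow> minor b n r c > 0"
    and r: "increasing_in n {1..d} r" and c: "increasing_in n {..Suc d} c"
  shows "minor b n r c > 0"
proof (cases "0 \<in> c ` {..<n} \<and> Suc d \<in> c ` {..<n}")
  case False
  moreover have "{..Suc d} - {0} = {1..Suc d}" "{..Suc d} - {Suc d} = {..d}" by auto
  ultimately have "increasing_in n {1..Suc d} c \<or> increasing_in n {..d} c"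
    using increasing_in_Diff[OF c, of 0] increasing_in_Diff[OF c, of "Suc d"] by auto
  then show ?thesis using left right r by blast
next
  case True
  then obtain k where n: "n = Suc k" by (cases n) auto
  have c0: "c 0 = 0" using increasing_in_first_eq_0[OF c[unfolded n]] True n by auto
  have ck: "c k = Suc d"
    using increasing_in_last_eq[OF c[unfolded n]] True n by auto
  have "n \<le> d"
  proof -
    have "inj_on r {..<n}" using r strict_mono_on_imp_inj_on by (auto simp: increasing_in_def)
    moreover have "r ` {..<n} \<subseteq> {1..d}" using r by (auto simp: increasing_in_def)
    ultimately show ?thesis using card_inj_on_le[of r "{..<n}" "{1..d}"] by simp
  qed
  \<comment> \<open>The least omitted column: \<open>c\<close> starts with
    \<open>0, ..., t - 1\<close> and then jumps past \<open>t\<close>. It exists since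
    \<open>c k = Suc d\<close> while \<open>k < d\<close>.\<close>
  define t where "t = (LEAST t. c t \<noteq> t)"
  have ne: "c k \<noteq> k" using ck n \<open>n \<le> d\<close> by simp
  have ct: "c t \<noteq> t" unfolding t_def using ne by (rule LeastI)
  have tk: "t \<le> k" unfolding t_def using ne by (rule Least_le)
  have less_t: "c i = i" if "i < t" for i using not_less_Least[OF that[unfolded t_def]] by simp
  have "t \<noteq> 0" using ct c0 by (cases "t = 0") auto
  then obtain m where t: "t = Suc m" by (cases t) auto
  obtain p where k: "k = Suc p" using tk t by (cases k) auto
  have mp: "m \<le> p" using tk t k by simp
  have ct': "c t > t" using increasing_in_index_le[OF c, of t] ct tk n by simp
  \<comment> \<open>\<open>x\<close> is \<open>c\<close> with the column \<open>t\<close> inserted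
    at position \<open>t = Suc m\<close>.\<close>
  define x where "x i = (if i \<le> t then i else c (i - 1))" for i
  have xc: "x \<circ> insert_index (Suc m) = c"
    using less_t t by (auto simp: x_def insert_index_def fun_eq_iff)
  have x_step: "x i < x (Suc i)" if "i \<le> k" for i
  proof -
    consider "i < t" | "i = t" | "i > t" by linarith
    then show ?thesis
    proof cases
      case 3
      then show ?thesis using increasing_inD(1)[OF c, of "i - 1" i] that n by (simp add: x_def)
    qed (use ct' in \<open>auto simp: x_def\<close>)
  qed
  have x_less: "x i < x j" if "i < j" "j \<le> Suc k" for i j
    using that
  proof (induction j)
    case (Suc j)
    then show ?case using x_step[of j] by (cases "i = j") auto
  qed simp
  have xk: "x (Suc k) = Suc d" using ck tk by (simp add: x_def)
  have xd: "x i \<le> d" if "i \<le> k" for i using x_less[of i "Suc k"] that xk by simp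
  have x: "increasing_in (Suc k) {..d} x"
    using x_less xd by (intro increasing_inI) auto
  have x': "increasing_in (Suc k) {1..Suc d} (x \<circ> Suc)"
  proof (rule increasing_inI)
    fix i j assume "i < j" "j < Suc k"
    then show "(x \<circ> Suc) i < (x \<circ> Suc) j" using x_less by simp
  next
    fix i assume "i < Suc k"
    then show "(x \<circ> Suc) i \<in> {1..Suc d}"
      using x_less[of 0 "Suc i"] x_less[of "Suc i" "Suc k"] xk by (cases "i = k") auto
  qed
  have x'': "increasing_in k {1..d} (x \<circ> Suc)"
    using increasing_in_butlast[OF x'] xk by (auto elim!: increasing_in_mono)
  have c': "increasing_in k {..d} c"
    using increasing_in_butlast[OF c[unfolded n]] ck by (auto elim!: increasing_in_mono)
  have c'': "increasing_in k {1..Suc d} (c \<circ> Suc)"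
    using increasing_in_Suc[OF c[unfolded n]] c0 by (auto elim!: increasing_in_mono)
  have r': "increasing_in k {1..d} (r \<circ> Suc)"
    using increasing_in_Suc[OF r[unfolded n]] by (auto elim!: increasing_in_mono)
  have r1: "increasing_in (Suc k) {1..d} r" using r n by simp
  \<comment> \<open>Each of the other five minors lacks column \<open>0\<close> or
    \<open>Suc d\<close> and is positive, so the relation can be solved for the first.\<close>
  have "minor b (Suc k) r c * minor b k (r \<circ> Suc) (x \<circ> Suc) =
      minor b (Suc k) r (x \<circ> Suc) * minor b k (r \<circ> Suc) c +
      minor b (Suc k) r x * minor b k (r \<circ> Suc) (c \<circ> Suc)"
    using minor_three_term[OF mp, of b r x] unfolding xc k by simp
  also have "\<dots> > 0"
    by (intro add_pos_pos mult_pos_pos right[OF r1 x'] left[OF r' c'] left[OF r1 x] right[OF r' c''])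
  finally have "minor b (Suc k) r c * minor b k (r \<circ> Suc) (x \<circ> Suc) > 0" .
  moreover have "minor b k (r \<circ> Suc) (x \<circ> Suc) > 0"
    by (rule left[OF r'], rule increasing_in_mono[OF x'']) auto
  ultimately show ?thesis unfolding n by (simp add: zero_less_mult_iff)
qed

text \<open>The bidiagonal relations settle the columns up to \<open>d\<close> and, after a shift by
  one, those from \<open>1\<close> to \<open>Suc d\<close>; \<open>minor_outer_columns_pos\<close>
  joins both cases.\<close>

lemma interior_positive_step:
  assumes a: "interior_positive d a" and d: "d > 0"
    and b0: "\<And>j. j \<le> Suc d \<Longrightarrow> b 0 j = of_bool (j = 0)"
    and bd: "\<And>j. j \<le> Suc d \<Longrightarrow> b (Suc d) j = of_bool (j = Suc d)"
    and left: "\<And>i j. i \<in> {1..d} \<Longrightarrow> j \<le> d \<Longrightarrow> b i j = \<alpha> i * a i j + \<beta> i * a (i - 1) j"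
    and right: "\<And>i j. i \<in> {1..d} \<Longrightarrow> j \<le> d \<Longrightarrow> b i (Suc j) = \<gamma> i * a i j + \<delta> i * a (i - 1) j"
    and pos: "\<And>i. i \<in> {1..d} \<Longrightarrow> \<alpha> i > 0 \<and> \<beta> i > 0 \<and> \<gamma> i > 0 \<and> \<delta> i > 0"
  shows "interior_positive (Suc d) b"
proof -
  have "minor b n r c > 0" if "increasing_in n {1..d} r" "increasing_in n {1..Suc d} c" for n r c
  proof -
    have "increasing_in n {..d} (\<lambda>i. c i - 1)"
    proof (rule increasing_inI)
      fix i j assume "i < j" "j < n"
      then show "c i - 1 < c j - 1"
        using increasing_inD(1)[OF that(2), of i j] increasing_inD(2)[OF that(2), of i] by auto
    next
      fix i assume "i < n"
      then show "c i - 1 \<in> {..d}" using increasing_inD(2)[OF that(2), of i] by auto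
    qed
    then have "minor (\<lambda>i j. b i (Suc j)) n r (\<lambda>i. c i - 1) > 0"
      using that(1) pos by (intro minor_bidiagonal_pos[OF a d right]) auto
    also have "minor (\<lambda>i j. b i (Suc j)) n r (\<lambda>i. c i - 1) = minor b n r c"
      using increasing_inD(2)[OF that(2)] by (intro minor_cong) (simp add: Suc_le_eq)
    finally show ?thesis .
  qed
  moreover have "minor b n r c > 0" if "increasing_in n {1..d} r" "increasing_in n {..d} c" for n r c
    using that pos by (intro minor_bidiagonal_pos[OF a d left]) auto
  ultimately have "minor b n r c > 0" if "increasing_in n {1..d} r" "increasing_in n {..Suc d} c" for n r c
    using minor_outer_columns_pos that by blast
  then show ?thesis
    using b0 bd by (simp add: interior_positive_def atLeastLessThanSuc_atLeastAtMost)
qed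

subsection \<open>Chains of faces\<close>

text \<open>\<open>chain_count k i\<close> is the number of chains of \<open>i\<close> nonempty sets whose union is a given set of size
  \<open>k\<close>, that is \<open>i!\<close> times a Stirling number of the second kind.\<close>

fun chain_count :: "nat \<Rightarrow> nat \<Rightarrow> nat" where
  "chain_count k 0 = of_bool (k = 0)"
| "chain_count k (Suc i) = (\<Sum>l<k. (k choose l) * chain_count l i)"

lemma chain_count_0_left: "chain_count 0 i = of_bool (i = 0)"
  by (cases i) auto

text \<open>The Stirling recurrence with factorials absorbed. Pascal's rule splits the sum: one half
  is the definition again plus its missing term \<open>l = k\<close>, the other follows by induction
  on \<open>i\<close>.\<close>

lemma chain_count_rec:
  "chain_count (Suc k) (Suc i) = Suc i * (chain_count k (Suc i) + chain_count k i)"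
proof (induction i arbitrary: k)
  case 0
  show ?case by (cases k) (auto simp: sum.lessThan_Suc_shift)
next
  case (Suc i)
  have "chain_count (Suc k) (Suc (Suc i)) =
      (\<Sum>l<k. (Suc k choose Suc l) * chain_count (Suc l) (Suc i))"
    unfolding chain_count.simps(2)[of "Suc k" "Suc i"] sum.lessThan_Suc_shift
    by (simp add: chain_count_0_left del: binomial_Suc_Suc chain_count.simps(2))
  also have "\<dots> = (\<Sum>l<k. (k choose l) * chain_count (Suc l) (Suc i)) +
      (\<Sum>l<k. (k choose Suc l) * chain_count (Suc l) (Suc i))"
    by (simp add: sum.distrib algebra_simps)
  also have "(\<Sum>l<k. (k choose Suc l) * chain_count (Suc l) (Suc i)) =
      (\<Sum>l<Suc k. (k choose l) * chain_count l (Suc i))"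
    by (simp add: sum.lessThan_Suc_shift chain_count_0_left del: sum.lessThan_Suc)
  also have "\<dots> = chain_count k (Suc (Suc i)) + chain_count k (Suc i)" by simp
  also have "(\<Sum>l<k. (k choose l) * chain_count (Suc l) (Suc i)) =
      Suc i * (chain_count k (Suc (Suc i)) + chain_count k (Suc i))"
    unfolding Suc by (simp add: sum.distrib sum_distrib_left algebra_simps)
  finally show ?case by (simp add: algebra_simps)
qed

lemma chain_count_eq_0: "k < i \<Longrightarrow> chain_count k i = 0"
  by (induction k i rule: chain_count.induct) auto

lemma chain_count_diag: "chain_count k k = fact k"
  by (induction k) (auto simp: chain_count_rec chain_count_eq_0 simp del: chain_count.simps(2))

text \<open>Prescribing the union rather than the largest member also covers the empty chain, whose
  union is \<open>{}\<close>.\<close>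

definition chains_to :: "'a set \<Rightarrow> nat \<Rightarrow> 'a set set set" where
  "chains_to \<sigma> i = {c. c \<subseteq> Pow \<sigma> - {{}} \<and> chain\<^sub>\<subseteq> c \<and> card c = i \<and> \<Union>c = \<sigma>}"

lemma finite_chains_to: "finite \<sigma> \<Longrightarrow> finite (chains_to \<sigma> i)"
  by (rule finite_subset[of _ "Pow (Pow \<sigma>)"]) (auto simp: chains_to_def)

lemma chain_Union_mem:
  assumes "finite c" "c \<noteq> {}" "chain\<^sub>\<subseteq> c"
  shows "\<Union>c \<in> c"
  using assms
proof (induction rule: finite_ne_induct)
  case (insert x F)
  then have "\<Union>F \<in> F" by (auto simp: chain_subset_def)
  moreover have "x \<subseteq> \<Union>F \<or> \<Union>F \<subseteq> x"
    using insert.prems \<open>\<Union>F \<in> F\<close> unfolding chain_subset_def by blast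
  ultimately show ?case by (auto simp: Un_absorb1 Un_absorb2)
qed auto

text \<open>The top of a nonempty chain is its union \<sigma>; without it the union \<tau> is a
  proper subset.\<close>

lemma chains_to_Suc:
  assumes "finite \<sigma>"
  shows "chains_to \<sigma> (Suc i) = insert \<sigma> ` (\<Union>\<tau>\<in>Pow \<sigma> - {\<sigma>}. chains_to \<tau> i)"
proof (intro equalityI subsetI)
  fix c assume "c \<in> chains_to \<sigma> (Suc i)"
  then have c: "c \<subseteq> Pow \<sigma> - {{}}" "chain\<^sub>\<subseteq> c" "card c = Suc i" "\<Union>c = \<sigma>"
    by (auto simp: chains_to_def)
  have fin: "finite c" using c(3) card.infinite by fastforce
  have "c \<noteq> {}" using c(3) by auto
  then have \<sigma>: "\<sigma> \<in> c" using chain_Union_mem[OF fin] c by auto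
  define c' where "c' = c - {\<sigma>}"
  have ch: "chain\<^sub>\<subseteq> c'" using c(2) by (auto simp: c'_def chain_subset_def)
  have "\<Union>c' \<noteq> \<sigma>"
  proof (cases "c' = {}")
    case True
    then show ?thesis using \<sigma> c(1) by auto
  next
    case False
    then have "\<Union>c' \<in> c'" using chain_Union_mem[OF _ False ch] fin by (auto simp: c'_def)
    then show ?thesis by (auto simp: c'_def)
  qed
  moreover have "c' \<in> chains_to (\<Union>c') i"
    using c ch fin \<sigma> by (auto simp: chains_to_def c'_def)
  moreover have "\<Union>c' \<subseteq> \<sigma>" using c(4) by (auto simp: c'_def)
  moreover have "c = insert \<sigma> c'" using \<sigma> by (auto simp: c'_def)
  ultimately show "c \<in> insert \<sigma> ` (\<Union>\<tau>\<in>Pow \<sigma> - {\<sigma>}. chains_to \<tau> i)" by blast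
next
  fix c assume "c \<in> insert \<sigma> ` (\<Union>\<tau>\<in>Pow \<sigma> - {\<sigma>}. chains_to \<tau> i)"
  then obtain \<tau> c' where \<tau>: "\<tau> \<subset> \<sigma>" and c': "c' \<subseteq> Pow \<tau> - {{}}" "chain\<^sub>\<subseteq> c'" "card c' = i" "\<Union>c' = \<tau>"
    and c: "c = insert \<sigma> c'"
    by (auto simp: chains_to_def)
  have "finite c'" using c'(1) \<tau> assms by (meson finite_Diff finite_Pow_iff finite_subset psubset_imp_subset)
  moreover have "\<sigma> \<notin> c'" using c'(1) \<tau> by auto
  ultimately have "card c = Suc i" using c c'(3) by simp
  moreover have "chain\<^sub>\<subseteq> c" using c c' \<tau> unfolding chain_subset_def by blast
  moreover have "c \<subseteq> Pow \<sigma> - {{}}" "\<Union>c = \<sigma>" using c c' \<tau> by auto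
  ultimately show "c \<in> chains_to \<sigma> (Suc i)" by (auto simp: chains_to_def)
qed

lemma sum_Pow_card:
  fixes f :: "nat \<Rightarrow> 'b::comm_semiring_1"
  assumes "finite A"
  shows "(\<Sum>B\<in>Pow A. f (card B)) = (\<Sum>l\<le>card A. of_nat (card A choose l) * f l)"
proof -
  have "(\<Sum>B\<in>Pow A. f (card B)) = (\<Sum>l\<le>card A. \<Sum>B\<in>{B \<in> Pow A. card B = l}. f (card B))"
    by (rule sum.group[symmetric]) (use assms card_mono in auto)
  also have "\<dots> = (\<Sum>l\<le>card A. of_nat (card A choose l) * f l)"
    using n_subsets[OF assms] by (intro sum.cong) auto
  finally show ?thesis .
qed

lemma card_chains_to:
  assumes "finite \<sigma>"
  shows "card (chains_to \<sigma> i) = chain_count (card \<sigma>) i"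
  using assms
proof (induction i arbitrary: \<sigma>)
  case 0
  have "chains_to \<sigma> 0 = (if \<sigma> = {} then {{}} else {})"
    using 0 by (auto simp: chains_to_def chain_subset_def dest: finite_subset)
  then show ?case using 0 by simp
next
  case (Suc i)
  have "inj_on (insert \<sigma>) (\<Union>\<tau>\<in>Pow \<sigma> - {\<sigma>}. chains_to \<tau> i)"
  proof (rule inj_onI)
    fix c c' assume *: "c \<in> (\<Union>\<tau>\<in>Pow \<sigma> - {\<sigma>}. chains_to \<tau> i)"
      "c' \<in> (\<Union>\<tau>\<in>Pow \<sigma> - {\<sigma>}. chains_to \<tau> i)" "insert \<sigma> c = insert \<sigma> c'"
    then have "\<sigma> \<notin> c" "\<sigma> \<notin> c'" by (auto simp: chains_to_def)
    then show "c = c'" using *(3) by (simp add: insert_ident)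
  qed
  then have "card (chains_to \<sigma> (Suc i)) = card (\<Union>\<tau>\<in>Pow \<sigma> - {\<sigma>}. chains_to \<tau> i)"
    unfolding chains_to_Suc[OF Suc.prems] by (rule card_image)
  also have "\<dots> = (\<Sum>\<tau>\<in>Pow \<sigma> - {\<sigma>}. card (chains_to \<tau> i))"
  proof (rule card_UN_disjoint)
    show "\<forall>\<tau>\<in>Pow \<sigma> - {\<sigma>}. finite (chains_to \<tau> i)"
      using Suc.prems by (auto intro: finite_chains_to finite_subset)
  qed (use Suc.prems in \<open>auto simp: chains_to_def\<close>)
  also have "\<dots> = (\<Sum>\<tau>\<in>Pow \<sigma> - {\<sigma>}. chain_count (card \<tau>) i)"
    using Suc by (intro sum.cong) (auto intro: finite_subset)
  \<comment> \<open>The term for \<tau> = \<sigma> is added on both sides so that the sum runs over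
    the whole power set and can be grouped by size.\<close>
  also have "\<dots> + chain_count (card \<sigma>) i = (\<Sum>\<tau>\<in>Pow \<sigma>. chain_count (card \<tau>) i)"
    using Suc.prems by (subst sum.remove[of "Pow \<sigma>" \<sigma>]) auto
  also have "\<dots> = chain_count (card \<sigma>) (Suc i) + chain_count (card \<sigma>) i"
    by (simp add: sum_Pow_card[OF Suc.prems, of "\<lambda>l. chain_count l i"] flip: lessThan_Suc_atMost)
  finally show ?case by simp
qed

section \<open>Face numbers and dimension of the subdivision\<close>

lemma num_faces_eq_0_iff: "finite \<Delta> \<Longrightarrow> num_faces \<Delta> i = 0 \<longleftrightarrow> i \<notin> card ` \<Delta>"
  by (auto simp: num_faces_def)

lemma complex_dim_eq_iff:
  assumes "finite \<Delta>" "\<Delta> \<noteq> {}"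
  shows "complex_dim \<Delta> = int d - 1 \<longleftrightarrow> num_faces \<Delta> d \<noteq> 0 \<and> (\<forall>i>d. num_faces \<Delta> i = 0)"
proof -
  have "complex_dim \<Delta> = int d - 1 \<longleftrightarrow> Max (card ` \<Delta>) = d" by (auto simp: complex_dim_def)
  also have "\<dots> \<longleftrightarrow> d \<in> card ` \<Delta> \<and> (\<forall>i\<in>card ` \<Delta>. i \<le> d)"
    using assms by (intro Max_eq_iff) auto
  also have "\<dots> \<longleftrightarrow> num_faces \<Delta> d \<noteq> 0 \<and> (\<forall>i>d. num_faces \<Delta> i = 0)"
    unfolding num_faces_eq_0_iff[OF assms(1)] by (meson not_le)
  finally show ?thesis .
qed

lemma finite_barycentric_subdivision:
  "finite \<Delta> \<Longrightarrow> finite (barycentric_subdivision \<Delta>)"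
  by (rule finite_subset[of _ "Pow \<Delta>"]) (auto simp: barycentric_subdivision_def chains_def)

text \<open>Chains are sorted by their union, which is again a face: the largest member, or the
  empty face for the empty chain.\<close>

lemma num_faces_barycentric_subdivision:
  assumes \<Delta>: "abstract_complex \<Delta>" and dim: "\<forall>i>d. num_faces \<Delta> i = 0"
  shows "num_faces (barycentric_subdivision \<Delta>) i = (\<Sum>k\<le>d. num_faces \<Delta> k * chain_count k i)"
proof -
  have fin: "finite \<Delta>" and fin': "\<sigma> \<in> \<Delta> \<Longrightarrow> finite \<sigma>" and closed: "\<sigma> \<in> \<Delta> \<Longrightarrow> \<tau> \<subseteq> \<sigma> \<Longrightarrow> \<tau> \<in> \<Delta>"
    and empty: "{} \<in> \<Delta>" for \<sigma> \<tau>
    using \<Delta> by (auto simp: abstract_complex_def)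
  have "{c \<in> barycentric_subdivision \<Delta>. card c = i} = (\<Union>\<sigma>\<in>\<Delta>. chains_to \<sigma> i)"
  proof (intro equalityI subsetI)
    fix c assume "c \<in> {c \<in> barycentric_subdivision \<Delta>. card c = i}"
    then have c: "c \<subseteq> \<Delta> - {{}}" "chain\<^sub>\<subseteq> c" "card c = i"
      by (auto simp: barycentric_subdivision_def chains_def)
    have "\<Union>c \<in> \<Delta>"
    proof (cases "c = {}")
      case False
      then show ?thesis using chain_Union_mem[OF _ False c(2)] c(1) fin finite_subset by blast
    qed (use empty in auto)
    moreover have "c \<in> chains_to (\<Union>c) i" using c by (auto simp: chains_to_def)
    ultimately show "c \<in> (\<Union>\<sigma>\<in>\<Delta>. chains_to \<sigma> i)" by blast
  next
    fix c assume "c \<in> (\<Union>\<sigma>\<in>\<Delta>. chains_to \<sigma> i)"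
    then obtain \<sigma> where \<sigma>: "\<sigma> \<in> \<Delta>" "c \<subseteq> Pow \<sigma> - {{}}" "chain\<^sub>\<subseteq> c" "card c = i"
      by (auto simp: chains_to_def)
    then have "c \<subseteq> \<Delta> - {{}}" using closed[OF \<sigma>(1)] by blast
    with \<sigma> show "c \<in> {c \<in> barycentric_subdivision \<Delta>. card c = i}"
      by (simp add: barycentric_subdivision_def chains_def)
  qed
  then have "num_faces (barycentric_subdivision \<Delta>) i = card (\<Union>\<sigma>\<in>\<Delta>. chains_to \<sigma> i)"
    by (simp add: num_faces_def)
  also have "\<dots> = (\<Sum>\<sigma>\<in>\<Delta>. card (chains_to \<sigma> i))"
  proof (rule card_UN_disjoint)
    show "\<forall>\<sigma>\<in>\<Delta>. finite (chains_to \<sigma> i)" using fin' by (auto intro: finite_chains_to)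
  qed (use fin in \<open>auto simp: chains_to_def\<close>)
  also have "\<dots> = (\<Sum>\<sigma>\<in>\<Delta>. chain_count (card \<sigma>) i)"
    by (intro sum.cong) (use fin' card_chains_to in auto)
  also have "\<dots> = (\<Sum>k\<le>d. \<Sum>\<sigma>\<in>{\<sigma>\<in>\<Delta>. card \<sigma> = k}. chain_count (card \<sigma>) i)"
  proof (rule sum.group[symmetric])
    show "card ` \<Delta> \<subseteq> {..d}"
      using dim num_faces_eq_0_iff[OF fin] by (metis atMost_iff not_le subsetI)
  qed (use fin in auto)
  also have "\<dots> = (\<Sum>k\<le>d. num_faces \<Delta> k * chain_count k i)"
    by (intro sum.cong) (auto simp: num_faces_def)
  finally show ?thesis .
qed

text \<open>A face with \<open>d\<close> vertices is the union of \<open>fact d\<close> chains of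
  \<open>d\<close> members, and no chain is longer. Hence both h-polynomials use the same
  \<open>d\<close>.\<close>

lemma complex_dim_barycentric_subdivision:
  assumes \<Delta>: "abstract_complex \<Delta>" and dim: "complex_dim \<Delta> = int d - 1"
  shows "complex_dim (barycentric_subdivision \<Delta>) = int d - 1"
proof -
  have fin: "finite \<Delta>" "\<Delta> \<noteq> {}" using \<Delta> by (auto simp: abstract_complex_def)
  have f: "num_faces \<Delta> d \<noteq> 0" "\<forall>i>d. num_faces \<Delta> i = 0"
    using dim complex_dim_eq_iff[OF fin] by auto
  have "{} \<in> barycentric_subdivision \<Delta>"
    by (auto simp: barycentric_subdivision_def chains_def chain_subset_def)
  moreover have "num_faces (barycentric_subdivision \<Delta>) i = 0" if "i > d" for i
    unfolding num_faces_barycentric_subdivision[OF \<Delta> f(2)]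
    by (rule sum.neutral) (use that chain_count_eq_0 in auto)
  moreover have "num_faces (barycentric_subdivision \<Delta>) d \<noteq> 0"
    unfolding num_faces_barycentric_subdivision[OF \<Delta> f(2)]
    using f(1) by (auto simp: chain_count_diag intro!: bexI[of _ d])
  ultimately show ?thesis
    using complex_dim_eq_iff[OF finite_barycentric_subdivision[OF fin(1)]] by blast
qed

subsection \<open>Refined Eulerian polynomials\<close>

text \<open>If \<open>p / (1 - x) ^ (d + 1)\<close> is the power series with coefficients \<open>g r\<close>, then
  \<open>times_index d p / (1 - x) ^ (d + 2)\<close> has the coefficients \<open>r * g r\<close>, and
  \<open>times_Suc_index d p / (1 - x) ^ (d + 2)\<close> has the coefficients \<open>(r + 1) * g r\<close>.\<close>

definition times_index :: "nat \<Rightarrow> real poly \<Rightarrow> real poly" where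
  "times_index d p = [:0, 1:] * ([:1, -1:] * pderiv p + of_nat (Suc d) * p)"

definition times_Suc_index :: "nat \<Rightarrow> real poly \<Rightarrow> real poly" where
  "times_Suc_index d p = [:1, -1:] * p + times_index d p"

lemma coeff_times_index:
  "coeff (times_index d p) 0 = 0"
  "coeff (times_index d p) (Suc i) = real (Suc i) * coeff p (Suc i) + (real d + 1 - real i) * coeff p i"
  by (cases i; auto simp: times_index_def coeff_pderiv coeff_pCons of_nat_poly algebra_simps)+

lemma coeff_times_Suc_index:
  "coeff (times_Suc_index d p) 0 = coeff p 0"
  "coeff (times_Suc_index d p) (Suc i) = (real i + 2) * coeff p (Suc i) + (real d - real i) * coeff p i"
  by (auto simp: times_Suc_index_def coeff_times_index coeff_pCons algebra_simps)

text \<open>Multiplying series coefficients by \<open>r\<close> and by \<open>r + 1\<close>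
  commutes.\<close>

lemma times_index_commute:
  "times_Suc_index (Suc d) (times_index d p) = times_index (Suc d) (times_Suc_index d p)"
proof (rule poly_eqI)
  fix i
  consider "i = 0" | "i = 1" | k where "i = Suc (Suc k)" by (cases i) (auto elim: nat.exhaust)
  then show "coeff (times_Suc_index (Suc d) (times_index d p)) i =
      coeff (times_index (Suc d) (times_Suc_index d p)) i"
    by cases (simp_all add: coeff_times_index coeff_times_Suc_index algebra_simps)
qed

lemma times_index_sum:
  "times_index d (\<Sum>j\<in>A. smult (c j) (p j)) = (\<Sum>j\<in>A. smult (c j) (times_index d (p j)))"
proof -
  have "times_index d (p + q) = times_index d p + times_index d q"
    "times_index d (smult r p) = smult r (times_index d p)" "times_index d 0 = 0" for p q r
    by (simp_all add: times_index_def pderiv_add pderiv_smult algebra_simps smult_add_right)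
  then show ?thesis by (induction A rule: infinite_finite_induct) auto
qed

text \<open>In the sense above, \<open>refined_eulerian d j\<close> belongs to \<open>g r = r ^ j * (r + 1) ^ (d - j)\<close>; it is
  column \<open>j\<close> of the Brenti--Welker matrix.  The value for \<open>j > d\<close> is junk.\<close>

fun refined_eulerian :: "nat \<Rightarrow> nat \<Rightarrow> real poly" where
  "refined_eulerian 0 j = 1"
| "refined_eulerian (Suc d) j =
     (if j \<le> d then times_Suc_index d (refined_eulerian d j) else times_index d (refined_eulerian d d))"

text \<open>For \<open>j < d\<close> the definition applies \<open>r + 1\<close> last; commuting the
  operators brings a factor \<open>r\<close> to the outside. This yields the relation for the last
  columns.\<close>

lemma refined_eulerian_Suc_Suc:
  "j \<le> d \<Longrightarrow> refined_eulerian (Suc d) (Suc j) = times_index d (refined_eulerian d j)"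
proof (induction d arbitrary: j)
  case (Suc d)
  show ?case
  proof (cases "j \<le> d")
    case True
    have "refined_eulerian (Suc (Suc d)) (Suc j) =
        times_Suc_index (Suc d) (refined_eulerian (Suc d) (Suc j))"
      using True by (subst refined_eulerian.simps(2)) simp
    also have "\<dots> = times_index (Suc d) (times_Suc_index d (refined_eulerian d j))"
      unfolding Suc.IH[OF True] times_index_commute ..
    also have "times_Suc_index d (refined_eulerian d j) = refined_eulerian (Suc d) j"
      using True by simp
    finally show ?thesis .
  next
    case False
    then have "j = Suc d" using Suc.prems by simp
    then show ?thesis by (subst refined_eulerian.simps(2)) simp
  qed
qed simp

lemma coeff_refined_eulerian_0: "j \<le> d \<Longrightarrow> coeff (refined_eulerian d j) 0 = of_bool (j = 0)"
  by (induction d arbitrary: j) (auto simp: coeff_times_index coeff_times_Suc_index)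

lemma coeff_refined_eulerian_eq_0: "d < i \<Longrightarrow> coeff (refined_eulerian d j) i = 0"
proof (induction d arbitrary: i j)
  case (Suc d)
  then show ?case by (cases i) (auto simp: coeff_times_index coeff_times_Suc_index)
qed auto

text \<open>At degree \<open>Suc d\<close> the old top coefficient gets weight 0 from
  \<open>times_Suc_index d\<close> and 1 from \<open>times_index d\<close>.\<close>

lemma coeff_refined_eulerian_top: "j \<le> d \<Longrightarrow> coeff (refined_eulerian d j) d = of_bool (j = d)"
  by (induction d arbitrary: j)
    (auto simp: coeff_times_index coeff_times_Suc_index coeff_refined_eulerian_eq_0)

lemma interior_positive_refined_eulerian:
  "interior_positive (Suc d) (\<lambda>i j. coeff (refined_eulerian (Suc d) j) i)"
proof (induction d)
  case 0
  \<comment> \<open>No row lies strictly between \<open>0\<close> and \<open>1\<close>, so only the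
    empty minor, which is 1, occurs.\<close>
  have "n = 0" if "increasing_in n {1..<Suc 0} r" for n r
    using that by (auto simp: increasing_in_def)
  then have "minor a n r c > 0" if "increasing_in n {1..<Suc 0} r" for a n r c
    using that by fastforce
  then show ?case
    unfolding interior_positive_def
    using coeff_refined_eulerian_0[of _ "Suc 0"] coeff_refined_eulerian_top[of _ "Suc 0"] by blast
next
  case (Suc d)
  show ?case
  \<comment> \<open>The weights are those of the two coefficient formulas at dimension
    \<open>Suc d\<close>, rewritten for \<open>i = Suc k\<close>; all are positive for
    \<open>i\<close> from \<open>1\<close> to \<open>Suc d\<close>.\<close>
  proof (rule interior_positive_step[OF Suc, where \<alpha> = "\<lambda>i. real i + 1" and
        \<beta> = "\<lambda>i. real d + 2 - real i" and \<gamma> = "\<lambda>i. real i" and \<delta> = "\<lambda>i. real d + 3 - real i"])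
    fix i j assume ij: "i \<in> {1..Suc d}" "j \<le> Suc d"
    then obtain k where k: "i = Suc k" by (cases i) auto
    show "coeff (refined_eulerian (Suc (Suc d)) j) i =
        (real i + 1) * coeff (refined_eulerian (Suc d) j) i +
        (real d + 2 - real i) * coeff (refined_eulerian (Suc d) j) (i - 1)"
      using ij by (subst refined_eulerian.simps(2))
        (simp add: k coeff_times_Suc_index algebra_simps del: refined_eulerian.simps)
    show "coeff (refined_eulerian (Suc (Suc d)) (Suc j)) i =
        real i * coeff (refined_eulerian (Suc d) j) i +
        (real d + 3 - real i) * coeff (refined_eulerian (Suc d) j) (i - 1)"
      using ij by (subst refined_eulerian_Suc_Suc)
        (auto simp: k coeff_times_index simp del: refined_eulerian.simps)
  qed (use coeff_refined_eulerian_0 coeff_refined_eulerian_top in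
      \<open>auto simp del: refined_eulerian.simps\<close>)
qed

section \<open>The matrix acting on polynomials\<close>

text \<open>In the series picture, a \<open>q\<close> of degree at most \<open>d\<close> is
  homogenised to degree \<open>d\<close> and evaluated at \<open>(r, r + 1)\<close>.\<close>

definition eulerian_transform :: "nat \<Rightarrow> real poly \<Rightarrow> real poly" where
  "eulerian_transform d q = (\<Sum>j\<le>d. smult (coeff q j) (refined_eulerian d j))"

lemma smult_sum_right: "smult c (sum f A) = (\<Sum>x\<in>A. smult c (f x))"
  by (induction A rule: infinite_finite_induct) (simp_all add: smult_add_right)

lemma eulerian_transform_sum:
  "eulerian_transform d (\<Sum>k\<in>A. smult (c k) (q k)) = (\<Sum>k\<in>A. smult (c k) (eulerian_transform d (q k)))"
  unfolding eulerian_transform_def smult_sum_right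
  by (subst sum.swap) (simp add: coeff_sum smult_sum)

lemma eulerian_transform_times_X:
  "eulerian_transform (Suc d) ([:0, 1:] * q) = times_index d (eulerian_transform d q)"
  unfolding eulerian_transform_def times_index_sum sum.atMost_Suc_shift
  by (auto simp: refined_eulerian_Suc_Suc simp del: refined_eulerian.simps intro!: sum.cong)

text \<open>The factor \<open>1 - X\<close> becomes \<open>(r + 1) - r = 1\<close>, so the series
  stays and only the power in its denominator grows.\<close>

lemma eulerian_transform_times_one_minus_X:
  assumes "degree q \<le> d"
  shows "eulerian_transform (Suc d) ([:1, -1:] * q) = [:1, -1:] * eulerian_transform d q"
proof -
  \<comment> \<open>Column \<open>Suc d\<close> is not built by \<open>times_Suc_index\<close>; the
    degree bound gives it coefficient 0.\<close>
  have "coeff q (Suc d) = 0" using assms by (simp add: coeff_eq_0)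
  then have "eulerian_transform (Suc d) q =
      (\<Sum>j\<le>d. smult (coeff q j) (times_Suc_index d (refined_eulerian d j)))"
    by (auto simp: eulerian_transform_def intro!: sum.cong)
  also have "\<dots> = [:1, -1:] * eulerian_transform d q + times_index d (eulerian_transform d q)"
    unfolding times_Suc_index_def eulerian_transform_def times_index_sum
    by (simp only: smult_add_right sum.distrib sum_distrib_left mult_smult_right)
  finally have "eulerian_transform (Suc d) q =
      [:1, -1:] * eulerian_transform d q + times_index d (eulerian_transform d q)" .
  moreover have "[:1, -1:] * q = q - [:0, 1:] * q" by simp
  then have "eulerian_transform (Suc d) ([:1, -1:] * q) =
      eulerian_transform (Suc d) q - eulerian_transform (Suc d) ([:0, 1:] * q)"
    by (simp only: eulerian_transform_def coeff_diff smult_diff_left sum_subtractf)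
  ultimately show ?thesis unfolding eulerian_transform_times_X by simp
qed

abbreviation face_poly :: "nat \<Rightarrow> nat \<Rightarrow> real poly" where
  "face_poly d i \<equiv> [:0, 1:] ^ i * [:1, -1:] ^ (d - i)"

lemma degree_face_poly: "i \<le> d \<Longrightarrow> degree (face_poly d i) \<le> d"
  by (simp add: degree_mult_eq degree_power_eq)

text \<open>Over \<open>(1 - x) ^ (d + 1)\<close>, \<open>face_poly d i\<close> has series
  coefficients \<open>r choose i\<close>, and \<open>r * (r choose i) = i * (r choose i) + Suc i *
  (r choose Suc i)\<close>. The proof differentiates directly.\<close>

lemma times_index_face_poly:
  assumes "i \<le> d"
  shows "times_index d (face_poly d i) =
    of_nat i * face_poly (Suc d) i + of_nat (Suc i) * face_poly (Suc d) (Suc i)"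
proof -
  obtain m where d: "d = i + m" using assms by (metis le_Suc_ex)
  define X Y :: "real poly" where "X = [:0, 1:]" and "Y = [:1, -1:]"
  have "pderiv X = 1" "pderiv Y = -1"
    by (simp_all add: X_def Y_def pderiv_pCons one_pCons)
  then have dX: "X * pderiv (X ^ i) = of_nat i * X ^ i" and dY: "Y * pderiv (Y ^ m) = - (of_nat m * Y ^ m)"
    by (cases i; cases m; simp add: pderiv_power_Suc of_nat_poly del: power_Suc of_nat_Suc; simp)+
  have "times_index d (X ^ i * Y ^ m) =
      Y * Y ^ m * (X * pderiv (X ^ i)) + X * X ^ i * (Y * pderiv (Y ^ m)) +
      of_nat (Suc d) * (X * (X ^ i * Y ^ m))"
    unfolding times_index_def X_def[symmetric] Y_def[symmetric] pderiv_mult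
    by (simp add: algebra_simps)
  also have "\<dots> = of_nat i * (X ^ i * Y ^ Suc m) + of_nat (Suc i) * (X ^ Suc i * Y ^ m)"
    unfolding dX dY d by (simp add: algebra_simps)
  finally show ?thesis by (simp add: d X_def Y_def Suc_diff_le)
qed

text \<open>The share in the subdivision's h-polynomial of the chains whose union is a given face
  with \<open>k\<close> vertices. For \<open>k \<le> d\<close> it belongs to
  \<open>g r = r ^ k\<close>.\<close>

definition chain_poly :: "nat \<Rightarrow> nat \<Rightarrow> real poly" where
  "chain_poly d k = (\<Sum>i\<le>d. smult (real (chain_count k i)) (face_poly d i))"

lemma times_index_chain_poly:
  assumes "k \<le> d"
  shows "times_index d (chain_poly d k) = chain_poly (Suc d) (Suc k)"
proof -
  have c: "chain_count k (Suc d) = 0" using assms by (simp add: chain_count_eq_0)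
  have "times_index d (chain_poly d k) =
      (\<Sum>i\<le>d. smult (real (chain_count k i * i)) (face_poly (Suc d) i)) +
      (\<Sum>i\<le>d. smult (real (chain_count k i * Suc i)) (face_poly (Suc d) (Suc i)))"
    unfolding chain_poly_def times_index_sum sum.distrib[symmetric]
    by (intro sum.cong refl, subst times_index_face_poly)
      (simp_all only: atMost_iff of_nat_poly of_nat_mult smult_add_right smult_smult mult_smult_left
         mult_pCons_left mult_1 pCons_0_0 add_0_right, simp_all)
  \<comment> \<open>The added term \<open>i = Suc d\<close> has chain count 0 and the term
    \<open>i = 0\<close> has factor 0, so the index can be shifted and
    \<open>chain_count_rec\<close> merges both sums.\<close>
  also have "(\<Sum>i\<le>d. smult (real (chain_count k i * i)) (face_poly (Suc d) i)) =
      (\<Sum>i\<le>Suc d. smult (real (chain_count k i * i)) (face_poly (Suc d) i))"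
    using c by simp
  also have "\<dots> = (\<Sum>i\<le>d. smult (real (chain_count k (Suc i) * Suc i)) (face_poly (Suc d) (Suc i)))"
    unfolding sum.atMost_Suc_shift by simp
  also have "\<dots> + (\<Sum>i\<le>d. smult (real (chain_count k i * Suc i)) (face_poly (Suc d) (Suc i))) =
      (\<Sum>i\<le>d. smult (real (chain_count (Suc k) (Suc i))) (face_poly (Suc d) (Suc i)))"
    unfolding sum.distrib[symmetric] smult_add_left[symmetric] chain_count_rec
    by (intro sum.cong refl arg_cong2[of _ _ _ _ smult]) (simp add: algebra_simps del: chain_count.simps)
  also have "\<dots> = chain_poly (Suc d) (Suc k)"
    unfolding chain_poly_def sum.atMost_Suc_shift by (simp del: chain_count.simps(2))
  finally show ?thesis .
qed

lemma one_minus_X_chain_poly: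
  assumes "k \<le> d"
  shows "[:1, -1:] * chain_poly d k = chain_poly (Suc d) k"
  unfolding chain_poly_def sum_distrib_left sum.atMost_Suc
  using assms by (auto simp: chain_count_eq_0 Suc_diff_le mult_ac simp del: mult_pCons_left
      chain_count.simps intro!: sum.cong)

text \<open>Both sides belong to \<open>g r = r ^ k\<close>: each X contributes \<open>r\<close>,
  each \<open>1 - X\<close> contributes 1. The induction strips off one such factor at a
  time.\<close>

lemma eulerian_transform_face_poly:
  "k \<le> d \<Longrightarrow> eulerian_transform d (face_poly d k) = chain_poly d k"
proof (induction d arbitrary: k)
  case 0
  then show ?case by (simp add: eulerian_transform_def chain_poly_def)
next
  case (Suc d)
  show ?case
  proof (cases "k \<le> d")
    case True
    then have "face_poly (Suc d) k = [:1, -1:] * face_poly d k"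
      by (simp add: Suc_diff_le mult_ac del: mult_pCons_left)
    then show ?thesis
      using True by (simp only: eulerian_transform_times_one_minus_X degree_face_poly Suc.IH
          one_minus_X_chain_poly)
  next
    case False
    then have k: "k = Suc d" using Suc.prems by simp
    have "face_poly (Suc d) k = [:0, 1:] * face_poly d d" unfolding k by simp
    then show ?thesis
      unfolding k by (simp only: eulerian_transform_times_X Suc.IH times_index_chain_poly order_refl)
  qed
qed

subsection \<open>The transformation matrix\<close>

lemma h_polynomial_face_poly:
  assumes "complex_dim \<Delta> = int d - 1"
  shows "h_polynomial \<Delta> = (\<Sum>i\<le>d. smult (real (num_faces \<Delta> i)) (face_poly d i))"
  using assms by (simp add: h_polynomial_def atLeast0AtMost of_nat_poly mult.assoc
      del: mult_pCons_right)

lemma h_polynomial_barycentric_subdivision: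
  assumes \<Delta>: "abstract_complex \<Delta>" and dim: "complex_dim \<Delta> = int d - 1"
  shows "h_polynomial (barycentric_subdivision \<Delta>) = eulerian_transform d (h_polynomial \<Delta>)"
proof -
  have f: "\<forall>i>d. num_faces \<Delta> i = 0"
    using dim complex_dim_eq_iff \<Delta> by (fastforce simp: abstract_complex_def)
  have "h_polynomial (barycentric_subdivision \<Delta>) =
      (\<Sum>i\<le>d. \<Sum>k\<le>d. smult (real (num_faces \<Delta> k * chain_count k i)) (face_poly d i))"
    unfolding h_polynomial_face_poly[OF complex_dim_barycentric_subdivision[OF \<Delta> dim]]
      num_faces_barycentric_subdivision[OF \<Delta> f]
    by (simp only: of_nat_sum smult_sum)
  also have "\<dots> = (\<Sum>k\<le>d. smult (real (num_faces \<Delta> k)) (chain_poly d k))"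
    unfolding chain_poly_def smult_sum_right by (subst sum.swap) simp
  also have "\<dots> = eulerian_transform d (h_polynomial \<Delta>)"
    unfolding h_polynomial_face_poly[OF dim] eulerian_transform_sum
    by (intro sum.cong) (simp_all add: eulerian_transform_face_poly)
  finally show ?thesis .
qed

lemma dim_h_vector: "complex_dim \<Delta> = int d - 1 \<Longrightarrow> dim_vec (h_vector \<Delta>) = Suc d"
  by (simp add: h_vector_def)

lemma index_mult_h_vector:
  assumes "H \<in> carrier_mat (Suc d) (Suc d)" "complex_dim \<Delta> = int d - 1" "i \<le> d"
  shows "(H *\<^sub>v h_vector \<Delta>) $ i = (\<Sum>j\<le>d. H $$ (i, j) * coeff (h_polynomial \<Delta>) j)"
  using assms by (auto simp: scalar_prod_def h_vector_def lessThan_Suc_atMost[symmetric]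
      atLeast0LessThan intro!: sum.cong)

definition eulerian_matrix :: "nat \<Rightarrow> real mat" where
  "eulerian_matrix d = mat (Suc d) (Suc d) (\<lambda>(i, j). coeff (refined_eulerian d j) i)"

lemma h_vector_barycentric_subdivision:
  assumes \<Delta>: "abstract_complex \<Delta>" and dim: "complex_dim \<Delta> = int d - 1"
  shows "h_vector (barycentric_subdivision \<Delta>) = eulerian_matrix d *\<^sub>v h_vector \<Delta>"
proof (rule eq_vecI)
  note dim' = complex_dim_barycentric_subdivision[OF \<Delta> dim]
  show "dim_vec (h_vector (barycentric_subdivision \<Delta>)) = dim_vec (eulerian_matrix d *\<^sub>v h_vector \<Delta>)"
    by (simp add: dim_h_vector[OF dim'] eulerian_matrix_def)
  fix i assume "i < dim_vec (eulerian_matrix d *\<^sub>v h_vector \<Delta>)"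
  then have i: "i \<le> d" by (simp add: eulerian_matrix_def)
  have "h_vector (barycentric_subdivision \<Delta>) $ i = coeff (eulerian_transform d (h_polynomial \<Delta>)) i"
    using i dim' by (simp add: h_vector_def h_polynomial_barycentric_subdivision[OF \<Delta> dim])
  also have "\<dots> = (\<Sum>j\<le>d. eulerian_matrix d $$ (i, j) * coeff (h_polynomial \<Delta>) j)"
    using i by (auto simp: eulerian_transform_def coeff_sum eulerian_matrix_def intro!: sum.cong)
  also have "\<dots> = (eulerian_matrix d *\<^sub>v h_vector \<Delta>) $ i"
    by (rule index_mult_h_vector[symmetric]) (use dim i in \<open>auto simp: eulerian_matrix_def\<close>)
  finally show "h_vector (barycentric_subdivision \<Delta>) $ i = (eulerian_matrix d *\<^sub>v h_vector \<Delta>) $ i" .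
qed

section \<open>Uniqueness of the transformation matrix\<close>

text \<open>The \<open>h\<close>-polynomials of these complexes, \<open>1 + (1 - x) ^ (d - k) - (1 - x) ^ d\<close> for \<open>k \<le> d\<close>, span
  the polynomials of degree at most \<open>d\<close>, which makes the transformation matrix unique.\<close>

definition two_simplices :: "nat \<Rightarrow> nat \<Rightarrow> nat set set" where
  "two_simplices d k = Pow {..<d} \<union> Pow {d..<d + k}"

lemma abstract_complex_two_simplices: "abstract_complex (two_simplices d k)"
  by (auto simp: abstract_complex_def two_simplices_def intro: finite_subset)

text \<open>The two simplices share exactly the empty face, hence the correction at
  \<open>i = 0\<close>.\<close>

lemma num_faces_two_simplices:
  "num_faces (two_simplices d k) i = (d choose i) + (k choose i) - of_bool (i = 0)"
proof -
  have "{\<sigma> \<in> two_simplices d k. card \<sigma> = i} =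
      {\<sigma>. \<sigma> \<subseteq> {..<d} \<and> card \<sigma> = i} \<union> {\<sigma>. \<sigma> \<subseteq> {d..<d + k} \<and> card \<sigma> = i}" (is "_ = ?A \<union> ?B")
    by (auto simp: two_simplices_def)
  moreover have "?A \<inter> ?B = (if i = 0 then {{}} else {})"
  proof -
    have "\<sigma> = {}" if "\<sigma> \<subseteq> {..<d}" "\<sigma> \<subseteq> {d..<d + k}" for \<sigma> using that by fastforce
    then have "?A \<inter> ?B = {\<sigma>. \<sigma> = {} \<and> card \<sigma> = i}" by blast
    also have "\<dots> = (if i = 0 then {{}} else {})" by (cases "i = 0") auto
    finally show ?thesis .
  qed
  moreover have "finite ?A" "finite ?B" by auto
  moreover have "card ?A = d choose i" "card ?B = k choose i"
    using n_subsets[of "{..<d}" i] n_subsets[of "{d..<d + k}" i] by auto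
  ultimately show ?thesis
    using card_Un_Int[of ?A ?B] by (auto simp: num_faces_def split: if_splits)
qed

lemma complex_dim_two_simplices:
  assumes "k \<le> d"
  shows "complex_dim (two_simplices d k) = int d - 1"
proof -
  have "finite (two_simplices d k)" "two_simplices d k \<noteq> {}" by (auto simp: two_simplices_def)
  then show ?thesis
    using assms by (subst complex_dim_eq_iff) (auto simp: num_faces_two_simplices)
qed

text \<open>The binomial theorem for \<open>(X + (1 - X)) ^ k = 1\<close>, with the surplus power of
  \<open>1 - X\<close> taken out.\<close>

lemma sum_binomial_face_poly:
  assumes "k \<le> d"
  shows "(\<Sum>i\<le>d. smult (real (k choose i)) (face_poly d i)) = [:1, -1:] ^ (d - k)"
proof -
  have "(\<Sum>i\<le>d. smult (real (k choose i)) (face_poly d i)) =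
      (\<Sum>i\<le>k. smult (real (k choose i)) (face_poly d i))"
    using assms by (intro sum.mono_neutral_right) auto
  also have "\<dots> = (\<Sum>i\<le>k. of_nat (k choose i) * [:0, 1:] ^ i * [:1, -1:] ^ (k - i)) * [:1, -1:] ^ (d - k)"
    unfolding sum_distrib_right
  proof (intro sum.cong refl)
    fix i assume "i \<in> {..k}"
    then have "d - i = (k - i) + (d - k)" using assms by simp
    then show "smult (real (k choose i)) (face_poly d i) =
        of_nat (k choose i) * [:0, 1:] ^ i * [:1, -1:] ^ (k - i) * [:1, -1:] ^ (d - k)"
      by (simp add: power_add of_nat_poly mult_ac del: mult_pCons_right)
  qed
  also have "\<dots> = ([:0, 1:] + [:1, -1:]) ^ k * [:1, -1:] ^ (d - k)"
    by (simp only: binomial_ring)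
  also have "[:0, 1:] + [:1, -1:] = (1 :: real poly)" by simp
  finally show ?thesis by simp
qed

lemma h_polynomial_two_simplices:
  assumes "k \<le> d"
  shows "h_polynomial (two_simplices d k) = 1 + [:1, -1:] ^ (d - k) - [:1, -1:] ^ d"
proof -
  \<comment> \<open>Writing the correction as \<open>0 choose i\<close> makes
    \<open>sum_binomial_face_poly\<close> apply to all three terms.\<close>
  have "real (num_faces (two_simplices d k) i) = real (d choose i) + real (k choose i) - real (0 choose i)" for i
    unfolding num_faces_two_simplices by (cases i) auto
  then have "h_polynomial (two_simplices d k) =
      (\<Sum>i\<le>d. smult (real (d choose i)) (face_poly d i)) + (\<Sum>i\<le>d. smult (real (k choose i)) (face_poly d i))
      - (\<Sum>i\<le>d. smult (real (0 choose i)) (face_poly d i))"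
    unfolding h_polynomial_face_poly[OF complex_dim_two_simplices[OF assms]]
    by (simp only: smult_add_left smult_diff_left sum.distrib sum_subtractf)
  then show ?thesis using assms by (simp add: sum_binomial_face_poly)
qed

text \<open>Spanning in dual form, to be applied to one row of a difference of two matrices. The
  complexes \<open>two_simplices\<close> test the functional on the powers of
  \<open>1 - X\<close>.\<close>

lemma h_polynomials_span:
  fixes a :: "nat \<Rightarrow> real"
  assumes "\<And>\<Delta> :: nat set set. abstract_complex \<Delta> \<Longrightarrow> complex_dim \<Delta> = int d - 1 \<Longrightarrow>
      (\<Sum>j\<le>d. a j * coeff (h_polynomial \<Delta>) j) = 0"
    and "i \<le> d"
  shows "a i = 0"
proof -
  define L where "L q = (\<Sum>j\<le>d. a j * coeff q j)" for q
  have L: "L (p + q) = L p + L q" "L (p - q) = L p - L q" "L (smult c p) = c * L p" for p q c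
    by (simp_all add: L_def sum.distrib sum_subtractf sum_distrib_left algebra_simps)
  have L_sum: "L (sum f A) = (\<Sum>x\<in>A. L (f x))" for f and A :: "nat set"
    by (induction A rule: infinite_finite_induct) (simp_all add: L(1), simp_all add: L_def)
  have h: "L 1 + L ([:1, -1:] ^ (d - k)) - L ([:1, -1:] ^ d) = 0" if "k \<le> d" for k
    using assms(1)[OF abstract_complex_two_simplices complex_dim_two_simplices[OF that]]
    unfolding h_polynomial_two_simplices[OF that] L_def[symmetric] L .
  \<comment> \<open>\<open>k = 0\<close> gives the value at 1, \<open>k = d\<close> that at the top
    power, and \<open>k = d - m\<close> then all other powers of \<open>1 - X\<close>.\<close>
  have "L 1 = 0" using h[of 0] by simp
  moreover have "L ([:1, -1:] ^ d) = 0" using h[of d] h[of 0] by simp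
  ultimately have Y: "L ([:1, -1:] ^ m) = 0" if "m \<le> d" for m
    using h[of "d - m"] that by simp
  \<comment> \<open>Since \<open>X = 1 - (1 - X)\<close>, these values determine the functional on
    monomials.\<close>
  have "[:0, 1:] = ([:-1:] * [:1, -1:] + 1 :: real poly)" by (simp add: one_pCons)
  then have "[:0, 1:] ^ i = ([:-1:] * [:1, -1:] + 1 :: real poly) ^ i"
    by (rule arg_cong[where f = "\<lambda>p. p ^ i"])
  also have "\<dots> = (\<Sum>m\<le>i. smult (real (i choose m) * (-1) ^ m) ([:1, -1:] ^ m))"
    unfolding binomial_ring power_mult_distrib
    by (intro sum.cong) (auto simp: of_nat_poly poly_const_pow mult_ac)
  finally have "L ([:0, 1:] ^ i) = (\<Sum>m\<le>i. real (i choose m) * (-1) ^ m * L ([:1, -1:] ^ m))"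
    by (simp only: L_sum L)
  also have "\<dots> = 0" using Y assms(2) by (intro sum.neutral) auto
  finally have "L (monom 1 i) = 0" by (simp add: monom_altdef)
  then show ?thesis
    using assms(2) by (simp add: L_def if_distrib[of "(*) _"] cong: if_cong)
qed

text \<open>Existence is \<open>h_vector_barycentric_subdivision\<close>; for uniqueness, each row
  of the difference of two candidates annihilates all h-polynomials.\<close>

lemma barycentric_transformation_matrix_eq:
  "barycentric_transformation_matrix d = eulerian_matrix d"
  unfolding barycentric_transformation_matrix_def
proof (rule the_equality)
  show "eulerian_matrix d \<in> carrier_mat (d + 1) (d + 1) \<and>
      (\<forall>\<Delta> :: nat set set. abstract_complex \<Delta> \<and> complex_dim \<Delta> = int d - 1 \<longrightarrow>
         h_vector (barycentric_subdivision \<Delta>) = eulerian_matrix d *\<^sub>v h_vector \<Delta>)"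
    using h_vector_barycentric_subdivision by (auto simp: eulerian_matrix_def)
next
  fix H :: "real mat"
  assume H: "H \<in> carrier_mat (d + 1) (d + 1) \<and>
      (\<forall>\<Delta> :: nat set set. abstract_complex \<Delta> \<and> complex_dim \<Delta> = int d - 1 \<longrightarrow>
         h_vector (barycentric_subdivision \<Delta>) = H *\<^sub>v h_vector \<Delta>)"
  have E: "eulerian_matrix d \<in> carrier_mat (Suc d) (Suc d)" by (simp add: eulerian_matrix_def)
  have H': "H \<in> carrier_mat (Suc d) (Suc d)" using H by simp
  show "H = eulerian_matrix d"
  proof (rule eq_matI)
    fix i j assume "i < dim_row (eulerian_matrix d)" "j < dim_col (eulerian_matrix d)"
    then have ij: "i \<le> d" "j \<le> d" by (auto simp: eulerian_matrix_def)
    have "H $$ (i, j) - eulerian_matrix d $$ (i, j) = 0"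
    proof (rule h_polynomials_span[OF _ ij(2)])
      fix \<Delta> :: "nat set set"
      assume \<Delta>: "abstract_complex \<Delta>" "complex_dim \<Delta> = int d - 1"
      then have "H *\<^sub>v h_vector \<Delta> = eulerian_matrix d *\<^sub>v h_vector \<Delta>"
        using H h_vector_barycentric_subdivision by metis
      then show "(\<Sum>j\<le>d. (H $$ (i, j) - eulerian_matrix d $$ (i, j)) * coeff (h_polynomial \<Delta>) j) = 0"
        using index_mult_h_vector[OF H' \<Delta>(2) ij(1)] index_mult_h_vector[OF E \<Delta>(2) ij(1)]
        by (simp add: left_diff_distrib sum_subtractf)
    qed
    then show "H $$ (i, j) = eulerian_matrix d $$ (i, j)" by simp
  qed (use H in \<open>auto simp: eulerian_matrix_def\<close>)
qed

theorem corollary3p3: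
  fixes d :: nat
  assumes "d \<ge> 1"
  shows "totally_positive (barycentric_transformation_matrix d)"
  unfolding barycentric_transformation_matrix_eq totally_positive_def
proof (intro allI impI)
  fix I J
  assume *: "I \<subseteq> {..<dim_row (eulerian_matrix d)} \<and> J \<subseteq> {..<dim_col (eulerian_matrix d)} \<and> card I = card J"
  define n where "n = card I"
  have sub: "I \<subseteq> {..d}" "J \<subseteq> {..d}" and card: "card I = n" "card J = n"
    using * by (auto simp: eulerian_matrix_def n_def)
  \<comment> \<open>\<open>pick\<close> lists a set in increasing order, so submatrices are minors
    in the present sense.\<close>
  have inc: "increasing_in n {..d} (pick K)" if "K \<subseteq> {..d}" "card K = n" for K
    using that pick_mono_le[of _ K] pick_in_set_le[of _ K] by (intro increasing_inI) auto
  have "{i. i < Suc d \<and> i \<in> K} = K" if "K \<subseteq> {..d}" for K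
    using that by auto
  then have "submatrix (eulerian_matrix d) I J =
      mat n n (\<lambda>(i, j). eulerian_matrix d $$ (pick I i, pick J j))"
    using sub card by (simp add: submatrix_def eulerian_matrix_def)
  also have "\<dots> = mat n n (\<lambda>(i, j). coeff (refined_eulerian d (pick J j)) (pick I i))"
    using increasing_inD(2)[OF inc[OF sub(1) card(1)]] increasing_inD(2)[OF inc[OF sub(2) card(2)]]
    by (intro eq_matI) (auto simp: eulerian_matrix_def less_Suc_eq_le)
  finally have "det (submatrix (eulerian_matrix d) I J) =
      minor (\<lambda>i j. coeff (refined_eulerian d j) i) n (pick I) (pick J)"
    by (simp add: minor_def)
  \<comment> \<open>\<open>d \<ge> 1\<close> supplies the successor form in which interior
    positivity is proved.\<close>
  moreover obtain d' where "d = Suc d'" using assms by (cases d) auto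
  ultimately show "det (submatrix (eulerian_matrix d) I J) \<ge> 0"
    using minor_all_rows(1)[OF _ inc[OF sub(1) card(1)] inc[OF sub(2) card(2)]]
      interior_positive_refined_eulerian[of d'] by simp
qed

end
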